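(* Let $G$ and $H$ be two connected non-trivial graphs. If $H$ is bipartite and $D(G)<r(H)$, then $\dim_l(G\boxtimes H)\le |V(H)|\cdot \dim_l(G)$.
   Context: $D(G)$ is the diameter of $G$ and $r(H)$ the radius of $H$ (minimum eccentricity). A set $S\subseteq V(G)$ is a local metric generator for a connected graph $G$ if for every two adjacent vertices $x,y$ there is $s\in S$ with $d_G(s,x)\ne d_G(s,y)$; $\dim_l(G)$ is the minimum cardinality of a local metric generator. The strong product $G\boxtimes H$ has vertex set $V(G)\times V(H)$, with $(a,b)\sim(c,d)$ iff ($a=c$ and $b\sim d$) or ($b=d$ and $a\sim c$) or ($a\sim c$ and $b\sim d$). *)

theory Defs
  imports "Graph_Theory.Graph_Theory"
begin

text \<open>
  Finite simple graphs are rendered by \<^locale>\<open>pair_graph\<close>: finite vertex set,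
  and a symmetric, irreflexive set of arcs that are ordered pairs of vertices.
\<close>

text \<open>
  Number of edges of a shortest walk, i.e. the weighted distance of \<^theory>\<open>Graph_Theory.Shortest_Path\<close>
  for unit weights. It lives in \<^typ>\<open>ereal\<close> (infinite between different components), so that the
  suprema and infima below need no side conditions.
\<close>

definition gdist :: "'a pair_pre_digraph \<Rightarrow> 'a \<Rightarrow> 'a \<Rightarrow> ereal" where
  "gdist G u v = wf_digraph.\<mu> (with_proj G) (\<lambda>_. 1) u v"

definition eccentricity :: "'a pair_pre_digraph \<Rightarrow> 'a \<Rightarrow> ereal" where
  "eccentricity G v = (SUP u\<in>pverts G. gdist G v u)"

definition graph_diameter :: "'a pair_pre_digraph \<Rightarrow> ereal" where
  "graph_diameter G = (SUP u\<in>pverts G. SUP v\<in>pverts G. gdist G u v)"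

definition graph_radius :: "'a pair_pre_digraph \<Rightarrow> ereal" where
  "graph_radius G = (INF v\<in>pverts G. eccentricity G v)"

definition bipartite :: "'a pair_pre_digraph \<Rightarrow> bool" where
  "bipartite G \<longleftrightarrow>
    (\<exists>X Y. X \<union> Y = pverts G \<and> X \<inter> Y = {} \<and>
      (\<forall>u v. u \<rightarrow>\<^bsub>G\<^esub> v \<longrightarrow> u \<in> X \<and> v \<in> Y \<or> u \<in> Y \<and> v \<in> X))"

definition strong_product ::
    "'a pair_pre_digraph \<Rightarrow> 'b pair_pre_digraph \<Rightarrow> ('a \<times> 'b) pair_pre_digraph" (infixr \<open>\<boxtimes>\<close> 70) where
  "G \<boxtimes> H =
    \<lparr> pverts = pverts G \<times> pverts H,
      parcs = {((a, b), (c, d)) | a b c d.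
        a \<in> pverts G \<and> b \<in> pverts H \<and> c \<in> pverts G \<and> d \<in> pverts H \<and>
        (a = c \<and> b \<rightarrow>\<^bsub>H\<^esub> d \<or> b = d \<and> a \<rightarrow>\<^bsub>G\<^esub> c \<or> a \<rightarrow>\<^bsub>G\<^esub> c \<and> b \<rightarrow>\<^bsub>H\<^esub> d)} \<rparr>"

definition local_metric_generator :: "'a pair_pre_digraph \<Rightarrow> 'a set \<Rightarrow> bool" where
  "local_metric_generator G S \<longleftrightarrow>
    S \<subseteq> pverts G \<and> (\<forall>x y. x \<rightarrow>\<^bsub>G\<^esub> y \<longrightarrow> (\<exists>s\<in>S. gdist G s x \<noteq> gdist G s y))"

definition local_metric_dimension :: "'a pair_pre_digraph \<Rightarrow> nat" where
  "local_metric_dimension G = (LEAST k. \<exists>S. local_metric_generator G S \<and> card S = k)"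

lemma (in pair_wf_digraph) gdist_altdef:
  "gdist G u v = (INF p\<in>{p. awalk u p v}. ereal (length p))"
proof -
  have "awalk_cost (\<lambda>_. 1) p = length p" for p :: "('a \<times> 'a) list"
    by (simp add: awalk_cost_def sum_list_triv)
  then show ?thesis
    by (simp add: gdist_def \<mu>_def)
qed

lemma pair_graph_strong_product:
  assumes "pair_graph G" "pair_graph H"
  shows "pair_graph (G \<boxtimes> H)"
proof -
  interpret G: pair_graph G by fact
  interpret H: pair_graph H by fact
  have fin: "finite (pverts G \<times> pverts H)"
    by simp
  have sub: "parcs (G \<boxtimes> H) \<subseteq> (pverts G \<times> pverts H) \<times> (pverts G \<times> pverts H)"
    by (auto simp: strong_product_def)
  have "sym (parcs (G \<boxtimes> H))"
    by (rule symI) (use G.graph_symmetric H.graph_symmetric in \<open>auto simp: strong_product_def\<close>)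
  then show ?thesis
    using sub finite_subset[OF sub] fin G.no_loops H.no_loops
    by unfold_locales (auto simp: strong_product_def symmetric_def arcs_ends_conv)
qed

end

theory Submission
  imports Defs
begin

text \<open>
  Distances in \<open>G \<boxtimes> H\<close> are maxima of the distances in the factors. Let \<open>A\<close> be a
  minimum local metric generator of \<open>G\<close>; then \<open>A \<times> V(H)\<close> is one of \<open>G \<boxtimes> H\<close>. An edge
  \<open>(a, b) (c, b)\<close> is resolved by \<open>(s, b)\<close>, where \<open>s \<in> A\<close> resolves \<open>a c\<close>. If instead \<open>b\<close> and \<open>d\<close>
  are adjacent, choose \<open>v\<close> with \<open>d(v, b) \<ge> D(G) + 1\<close>, which exists since \<open>D(G) < r(H)\<close>.
  Then \<open>d(v, d) \<ge> D(G)\<close> as well, so both \<open>(a, b)\<close> and \<open>(c, d)\<close> have the same distance from \<open>(s, v)\<close>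
  as their second components have from \<open>v\<close>, and these differ in parity because \<open>H\<close> is bipartite.
\<close>

section \<open>Distances\<close>

lemma relpow_Suc_iff: "(x, z) \<in> R ^^ Suc n \<longleftrightarrow> (\<exists>y. (x, y) \<in> R \<and> (y, z) \<in> R ^^ n)"
  by (metis relpow_Suc_D2 relpow_Suc_I2)

context pair_wf_digraph
begin

text \<open>The hypothesis on \<open>u\<close> matters for \<open>n = 0\<close>: the zeroth power is
  the identity on the whole type, whereas an empty walk has to start at a vertex.\<close>

lemma awalk_iff_relpow:
  "u \<in> pverts G \<Longrightarrow> (\<exists>p. awalk u p v \<and> length p = n) \<longleftrightarrow> (u, v) \<in> parcs G ^^ n"
proof (induction n arbitrary: u)
  case 0
  then show ?case by (auto simp: awalk_Nil_iff)
next
  case (Suc n)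
  have "(\<exists>p. awalk u p v \<and> length p = Suc n) \<longleftrightarrow>
      (\<exists>w. (u, w) \<in> parcs G \<and> (\<exists>p. awalk w p v \<and> length p = n))"
  proof
    assume "\<exists>p. awalk u p v \<and> length p = Suc n"
    then show "\<exists>w. (u, w) \<in> parcs G \<and> (\<exists>p. awalk w p v \<and> length p = n)"
      by (fastforce simp: length_Suc_conv awalk_Cons_iff)
  next
    assume "\<exists>w. (u, w) \<in> parcs G \<and> (\<exists>p. awalk w p v \<and> length p = n)"
    then obtain w p where "(u, w) \<in> parcs G" "awalk w p v" "length p = n"
      by blast
    then show "\<exists>p. awalk u p v \<and> length p = Suc n"
      by (intro exI[of _ "(u, w) # p"]) (simp add: awalk_Cons_iff)
  qed
  also have "\<dots> \<longleftrightarrow> (\<exists>w. (u, w) \<in> parcs G \<and> (w, v) \<in> parcs G ^^ n)"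
    using Suc.IH in_arcsD2 by blast
  also have "\<dots> \<longleftrightarrow> (u, v) \<in> parcs G ^^ Suc n"
    by (simp add: relpow_Suc_iff del: relpow.simps)
  finally show ?case .
qed

lemma gdist_le_awalk: "awalk u p v \<Longrightarrow> gdist G u v \<le> ereal (length p)"
  by (auto simp: gdist_altdef intro: INF_lower)

lemma gdist_attained:
  assumes "awalk u p v"
  obtains q where "awalk u q v" "gdist G u v = ereal (length q)"
proof -
  define n where "n = (LEAST n. \<exists>q. awalk u q v \<and> length q = n)"
  have "\<exists>q. awalk u q v \<and> length q = n"
    unfolding n_def by (rule LeastI_ex) (use assms in blast)
  then obtain q where q: "awalk u q v" "length q = n" by blast
  have "ereal (length q) \<le> gdist G u v"
    unfolding gdist_altdef q n_def by (rule INF_greatest) (auto intro: Least_le)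
  with q(1) show thesis
    using gdist_le_awalk that order_antisym by blast
qed

text \<open>The infimum runs over natural numbers, so it is attained as soon as there is a walk; an
  empty infimum is \<infinity>.\<close>

lemma gdist_cases:
  obtains (awalk) q where "awalk u q v" "gdist G u v = ereal (length q)"
  | (unreachable) "gdist G u v = \<infinity>" "\<nexists>p. awalk u p v"
proof (cases "\<exists>p. awalk u p v")
  case True
  then show thesis using gdist_attained awalk by blast
next
  case False
  then show thesis
    by (intro unreachable) (auto simp: gdist_altdef top_ereal_def)
qed

text \<open>The reflexive closure permits idle steps, so a walk of length at most \<open>n\<close>
  can be padded to exactly \<open>n\<close> steps. In this form distance bounds split over the
  factors of a strong product.\<close>

lemma gdist_le_iff_relpow:
  assumes "u \<in> pverts G"
  shows "gdist G u v \<le> ereal (real n) \<longleftrightarrow> (u, v) \<in> ((parcs G)\<^sup>=) ^^ n"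
proof -
  have "gdist G u v \<le> ereal (real n) \<longleftrightarrow> (\<exists>p. awalk u p v \<and> length p \<le> n)"
  proof
    assume "gdist G u v \<le> ereal (real n)"
    then show "\<exists>p. awalk u p v \<and> length p \<le> n"
      by (cases rule: gdist_cases[of u v]) auto
  next
    assume "\<exists>p. awalk u p v \<and> length p \<le> n"
    then obtain p where "awalk u p v" "length p \<le> n"
      by blast
    then show "gdist G u v \<le> ereal (real n)"
      using gdist_le_awalk[of u p v] by (simp add: order_trans)
  qed
  also have "\<dots> \<longleftrightarrow> (\<exists>m\<le>n. (u, v) \<in> parcs G ^^ m)"
    using awalk_iff_relpow[OF assms] by metis
  also have "\<dots> \<longleftrightarrow> (u, v) \<in> ((parcs G)\<^sup>=) ^^ n"
  proof (induction n arbitrary: v)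
    case (Suc n)
    \<comment> \<open>The first disjunct will become a final idle step, the second a final
      arc.\<close>
    have "(\<exists>m\<le>Suc n. (u, v) \<in> parcs G ^^ m) \<longleftrightarrow>
        (\<exists>m\<le>n. (u, v) \<in> parcs G ^^ m) \<or> (\<exists>m\<le>n. (u, v) \<in> parcs G ^^ Suc m)"
      (is "?P \<longleftrightarrow> ?Q \<or> ?R")
    proof
      assume ?P
      then show "?Q \<or> ?R" by (metis le_Suc_eq order_refl)
    next
      assume "?Q \<or> ?R"
      then show ?P by (metis le_SucI Suc_le_mono)
    qed
    also have "\<dots> \<longleftrightarrow> (\<exists>w. (\<exists>m\<le>n. (u, w) \<in> parcs G ^^ m) \<and> (w, v) \<in> (parcs G)\<^sup>=)"
      by auto
    finally show ?case
      using Suc.IH by auto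
  qed simp
  finally show ?thesis .
qed

lemma gdist_arc_le:
  assumes "u \<in> pverts G" "(v, w) \<in> parcs G"
  shows "gdist G u w \<le> gdist G u v + 1"
proof (cases rule: gdist_cases[of u v])
  case (awalk q)
  then have "(u, w) \<in> ((parcs G)\<^sup>=) ^^ Suc (length q)"
    using assms gdist_le_iff_relpow[of u v "length q"] by auto
  then have "gdist G u w \<le> ereal (real (Suc (length q)))"
    using assms(1) gdist_le_iff_relpow by blast
  with awalk show ?thesis by (simp add: add.commute)
qed simp

end

text \<open>Distances are natural numbers or \<infinity>, so their natural upper bounds determine
  them. The two graphs may have different vertex types, as needed to compare a product with a
  factor.\<close>

lemma gdist_eqI:
  assumes "pair_wf_digraph G" "pair_wf_digraph H"
    and "\<And>n. gdist G u v \<le> ereal (real n) \<longleftrightarrow> gdist H x y \<le> ereal (real n)"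
  shows "gdist G u v = gdist H x y"
proof -
  interpret G: pair_wf_digraph G by fact
  interpret H: pair_wf_digraph H by fact
  show ?thesis
    by (cases rule: G.gdist_cases[of u v]; cases rule: H.gdist_cases[of x y])
      (use assms(3) in \<open>force intro: order_antisym\<close>)+
qed

lemma (in pair_graph) connected_gdist_attained:
  assumes "connected (with_proj G)" "u \<in> pverts G" "v \<in> pverts G"
  obtains q where "awalk u q v" "gdist G u v = ereal (length q)"
proof -
  have "strongly_connected (with_proj G)"
    using symmetric_connected_imp_strongly_connected assms(1) sym_arcs by blast
  then have "u \<rightarrow>\<^sup>*\<^bsub>with_proj G\<^esub> v"
    using assms by auto
  then show thesis
    using gdist_attained that reachable_awalk by blast
qed

lemma (in pair_graph) gdist_sym: "gdist G u v = gdist G v u"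
proof -
  have length_rev: "length (rev_path p) = length p" for p :: "('a \<times> 'a) awalk"
    by (induction p) auto
  have "gdist G x y \<le> gdist G y x" for x y
  proof (cases rule: gdist_cases[of y x])
    case (awalk q)
    then show ?thesis
      using gdist_le_awalk[of x "rev_path q" y] length_rev by simp
  qed simp
  then show ?thesis by (simp add: order_antisym)
qed

text \<open>A step of the product, idle steps included, is an independent choice of a possibly idle
  step in each factor. Hence walks in the factors padded to the same length combine into one
  walk.\<close>

lemma relpow_strong_product:
  assumes "pair_graph G" "pair_graph H" "a \<in> pverts G" "b \<in> pverts H"
  shows "((a, b), (c, d)) \<in> ((parcs (G \<boxtimes> H))\<^sup>=) ^^ n \<longleftrightarrow>
    (a, c) \<in> ((parcs G)\<^sup>=) ^^ n \<and> (b, d) \<in> ((parcs H)\<^sup>=) ^^ n"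
proof -
  interpret G: pair_graph G by fact
  interpret H: pair_graph H by fact
  show ?thesis
    using assms(3,4)
  proof (induction n arbitrary: a b)
    case (Suc n)
    have step: "((a, b), (a', b')) \<in> (parcs (G \<boxtimes> H))\<^sup>= \<longleftrightarrow>
        (a, a') \<in> (parcs G)\<^sup>= \<and> (b, b') \<in> (parcs H)\<^sup>=" for a' b'
      using Suc.prems G.in_arcsD2 H.in_arcsD2
      by (auto simp: strong_product_def arcs_ends_conv)
    have verts: "a' \<in> pverts G" "b' \<in> pverts H"
      if "(a, a') \<in> (parcs G)\<^sup>=" "(b, b') \<in> (parcs H)\<^sup>=" for a' b'
      using that Suc.prems G.in_arcsD2 H.in_arcsD2 by auto
    have "((a, b), (c, d)) \<in> ((parcs (G \<boxtimes> H))\<^sup>=) ^^ Suc n \<longleftrightarrow>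
        (\<exists>a' b'. (a, a') \<in> (parcs G)\<^sup>= \<and> (b, b') \<in> (parcs H)\<^sup>= \<and>
          (a', c) \<in> ((parcs G)\<^sup>=) ^^ n \<and> (b', d) \<in> ((parcs H)\<^sup>=) ^^ n)"
      unfolding relpow_Suc_iff split_paired_Ex step using Suc.IH verts by blast
    also have "\<dots> \<longleftrightarrow> (a, c) \<in> ((parcs G)\<^sup>=) ^^ Suc n \<and> (b, d) \<in> ((parcs H)\<^sup>=) ^^ Suc n"
      unfolding relpow_Suc_iff by blast
    finally show ?case .
  qed auto
qed

lemma gdist_strong_product:
  assumes "pair_graph G" "pair_graph H" "a \<in> pverts G" "b \<in> pverts H"
  shows "gdist (G \<boxtimes> H) (a, b) (c, d) = max (gdist G a c) (gdist H b d)"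
proof -
  interpret G: pair_graph G by fact
  interpret H: pair_graph H by fact
  interpret P: pair_graph "G \<boxtimes> H"
    using assms by (intro pair_graph_strong_product)
  have "(a, b) \<in> pverts (G \<boxtimes> H)"
    using assms by (simp add: strong_product_def)
  then have iff: "gdist (G \<boxtimes> H) (a, b) (c, d) \<le> ereal (real n) \<longleftrightarrow>
      gdist G a c \<le> ereal (real n) \<and> gdist H b d \<le> ereal (real n)" for n
    using assms P.gdist_le_iff_relpow G.gdist_le_iff_relpow H.gdist_le_iff_relpow
      relpow_strong_product by metis
  show ?thesis
  proof (cases "gdist G a c \<le> gdist H b d")
    case True
    then have "gdist (G \<boxtimes> H) (a, b) (c, d) = gdist H b d"
      using iff order_trans
      by (intro gdist_eqI P.pair_wf_digraph H.pair_wf_digraph) blast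
    with True show ?thesis by (simp add: max_def)
  next
    case False
    then have "gdist (G \<boxtimes> H) (a, b) (c, d) = gdist G a c"
      using iff order_trans linear
      by (intro gdist_eqI P.pair_wf_digraph G.pair_wf_digraph) blast
    with False show ?thesis by (simp add: max_def)
  qed
qed

text \<open>Walks alternate between the two classes, so equal distances from \<open>u\<close> would
  put both ends of an arc into the same class. Connectedness rules out that both distances are
  infinite.\<close>

lemma (in pair_graph) bipartite_gdist_neq:
  assumes "bipartite G" "connected (with_proj G)" "u \<in> pverts G" "(v, w) \<in> parcs G"
  shows "gdist G u v \<noteq> gdist G u w"
proof
  assume eq: "gdist G u v = gdist G u w"
  obtain X Y where XY: "X \<inter> Y = {}"
    "\<And>x y. (x, y) \<in> parcs G \<Longrightarrow> x \<in> X \<and> y \<in> Y \<or> x \<in> Y \<and> y \<in> X"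
    using assms(1) by (auto simp: bipartite_def arcs_ends_conv)
  have parity: "even (length p) \<longleftrightarrow> (x \<in> X \<longleftrightarrow> y \<in> X)" if "awalk x p y" for x p y
    using that
  proof (induction p arbitrary: x)
    case (Cons e p)
    then show ?case
      using XY(1) XY(2)[of "fst e" "snd e"] by (auto simp: awalk_Cons_iff)
  qed (simp add: awalk_Nil_iff)
  obtain p where "awalk u p v" "gdist G u v = ereal (length p)"
    using assms wellformed' connected_gdist_attained by metis
  moreover obtain q where "awalk u q w" "gdist G u w = ereal (length q)"
    using assms wellformed' connected_gdist_attained by metis
  ultimately have "v \<in> X \<longleftrightarrow> w \<in> X"
    using eq parity by (metis ereal.inject of_nat_eq_iff)
  with XY assms(4) show False by blast
qed

section \<open>Local metric generators\<close>

text \<open>The tail of an arc resolves it, being at distance 0 from itself only. This guarantees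
  that the \<open>LEAST\<close> in the dimension is taken over a nonempty set.\<close>

lemma (in pair_graph) local_metric_generator_pverts: "local_metric_generator G (pverts G)"
proof -
  have "gdist G x x \<noteq> gdist G x y" if "(x, y) \<in> parcs G" for x y
  proof -
    have x: "x \<in> pverts G" and "x \<noteq> y"
      using that wellformed' no_loops' by auto
    then have "\<not> gdist G x y \<le> ereal (real 0)" "gdist G x x \<le> ereal (real 0)"
      by (subst gdist_le_iff_relpow; simp)+
    then show ?thesis by auto
  qed
  then show ?thesis
    using wellformed' by (fastforce simp: local_metric_generator_def arcs_ends_conv)
qed

lemma local_metric_dimension_le:
  "local_metric_generator G S \<Longrightarrow> local_metric_dimension G \<le> card S"
  unfolding local_metric_dimension_def by (rule Least_le) blast

lemma (in pair_graph) local_metric_dimension_attained: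
  obtains S where "local_metric_generator G S" "card S = local_metric_dimension G"
proof -
  have "\<exists>S. local_metric_generator G S \<and> card S = local_metric_dimension G"
    unfolding local_metric_dimension_def
    by (rule LeastI_ex) (use local_metric_generator_pverts in blast)
  then show thesis using that by blast
qed

lemma (in pair_graph) connected_ex_arc:
  assumes "connected (with_proj G)" "card (pverts G) \<ge> 2"
  obtains u v where "(u, v) \<in> parcs G"
proof -
  obtain u v where uv: "u \<in> pverts G" "v \<in> pverts G" "u \<noteq> v"
    using assms(2) by (metis card_le_Suc0_iff_eq finite_verts not_less_eq_eq numeral_2_eq_2
        with_proj_simps(1))
  then obtain p where "awalk u p v"
    using connected_gdist_attained[OF assms(1)] by metis
  with uv(3) that show thesis
    by (cases p) (auto simp: awalk_Nil_iff awalk_Cons_iff)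
qed

lemma gdist_le_diameter:
  "u \<in> pverts G \<Longrightarrow> v \<in> pverts G \<Longrightarrow> gdist G u v \<le> graph_diameter G"
  unfolding graph_diameter_def by (meson SUP_upper2 order_refl)

lemma local_metric_generator_strong_product:
  assumes "pair_graph G" "pair_graph H"
    and "connected (with_proj G)" "connected (with_proj H)"
    and "bipartite H" "graph_diameter G < graph_radius H"
    and A: "local_metric_generator G A" "A \<noteq> {}"
  shows "local_metric_generator (G \<boxtimes> H) (A \<times> pverts H)"
proof -
  interpret G: pair_graph G by fact
  interpret H: pair_graph H by fact
  have sub: "A \<subseteq> pverts G"
    using A(1) by (simp add: local_metric_generator_def)
  note dist = gdist_strong_product[OF assms(1,2)]
  \<comment> \<open>The three kinds of product arcs reduce to two cases: once \<open>b\<close> and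
    \<open>d\<close> are adjacent, the relation between \<open>a\<close> and \<open>c\<close> is
    irrelevant.\<close>
  have "\<exists>s\<in>A \<times> pverts H. gdist (G \<boxtimes> H) s (a, b) \<noteq> gdist (G \<boxtimes> H) s (c, d)"
    if verts: "a \<in> pverts G" "b \<in> pverts H" "c \<in> pverts G" "d \<in> pverts H"
      and arc: "b = d \<and> (a, c) \<in> parcs G \<or> (b, d) \<in> parcs H" for a b c d
    using arc
  proof
    assume bd: "b = d \<and> (a, c) \<in> parcs G"
    then obtain s where s: "s \<in> A" "gdist G s a \<noteq> gdist G s c"
      using A(1) unfolding local_metric_generator_def by (fastforce simp: arcs_ends_conv)
    have "gdist H b b \<le> 0"
      using verts H.gdist_le_iff_relpow[of b b 0] by (simp add: zero_ereal_def)
    moreover have "0 \<le> gdist G x y" for x y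
      by (auto simp: G.gdist_altdef intro: INF_greatest)
    \<comment> \<open>A landmark in the layer of \<open>b\<close> therefore measures distances
      within that layer exactly as \<open>G\<close> does.\<close>
    ultimately have "max (gdist G x y) (gdist H b b) = gdist G x y" for x y
      by (meson max_absorb1 order_trans)
    with s sub verts bd show ?thesis
      by (intro bexI[of _ "(s, b)"]) (auto simp: dist subset_iff)
  next
    assume bd: "(b, d) \<in> parcs H"
    \<comment> \<open>Any element of \<open>A\<close> will do, since the second coordinate of the
      landmark does the resolving.\<close>
    obtain s where s: "s \<in> A" "s \<in> pverts G"
      using A(2) sub by blast
    have "graph_diameter G < eccentricity H b"
      using assms(6) verts unfolding graph_radius_def
      by (metis INF_lower order.strict_trans2)
    then obtain v where v: "v \<in> pverts H" "graph_diameter G < gdist H b v"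
      by (auto simp: eccentricity_def less_SUP_iff)
    have far_b: "gdist G s a < gdist H v b"
      using v gdist_le_diameter[of s G a] s verts H.gdist_sym[of b v] by auto
    have "gdist G s c < gdist H v b"
      using v gdist_le_diameter[of s G c] s verts H.gdist_sym[of b v] by auto
    also have "\<dots> \<le> gdist H v d + 1"
      using H.gdist_arc_le[OF v(1)] H.arcs_symmetric bd by blast
    finally have "gdist G s c < gdist H v d + 1" .
    \<comment> \<open>Finite distances are integers, so the strict bound with \<open>+ 1\<close>
      sharpens to a weak bound without it.\<close>
    moreover obtain k where "gdist G s c = ereal (real k)"
      using G.connected_gdist_attained[OF assms(3) s(2) verts(3)] by blast
    moreover obtain l where "gdist H v d = ereal (real l)"
      using H.connected_gdist_attained[OF assms(4) v(1) verts(4)] by blast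
    ultimately have far_d: "gdist G s c \<le> gdist H v d"
      by auto
    have "gdist H v b \<noteq> gdist H v d"
      using H.bipartite_gdist_neq assms(4,5) v(1) bd by blast
    \<comment> \<open>By \<open>far_b\<close> and \<open>far_d\<close> both maxima equal the
      distance in \<open>H\<close>; the weak inequality of \<open>far_d\<close> suffices for
      this.\<close>
    then show ?thesis
      using s v(1) far_b far_d
      by (intro bexI[of _ "(s, v)"]) (auto simp: dist max_def)
  qed
  then show ?thesis
    using sub G.no_loops'
    by (force simp: local_metric_generator_def arcs_ends_conv strong_product_def)
qed

theorem theorem7:
  fixes G :: "'a pair_pre_digraph" and H :: "'b pair_pre_digraph"
  assumes "pair_graph G" and "pair_graph H"
    and "connected (with_proj G)" and "connected (with_proj H)"
    and "card (pverts G) \<ge> 2" and "card (pverts H) \<ge> 2"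
    and "bipartite H"
    and "graph_diameter G < graph_radius H"
  shows "local_metric_dimension (G \<boxtimes> H) \<le> card (pverts H) * local_metric_dimension G"
proof -
  interpret G: pair_graph G by fact
  obtain A where A: "local_metric_generator G A" "card A = local_metric_dimension G"
    using G.local_metric_dimension_attained .
  obtain u v where "(u, v) \<in> parcs G"
    using G.connected_ex_arc assms(3,5) .
  \<comment> \<open>Some element of \<open>A\<close> must resolve the arc just found.\<close>
  then have "A \<noteq> {}"
    using A(1) by (auto simp: local_metric_generator_def arcs_ends_conv)
  then have "local_metric_generator (G \<boxtimes> H) (A \<times> pverts H)"
    using assms A(1) by (intro local_metric_generator_strong_product)
  from local_metric_dimension_le[OF this] show ?thesis
    using A(2) by (simp add: card_cartesian_product mult.commute)
qed

end
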